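(* Let $n>0$ be an integer, let $r\ge2$ and $k>r$ be integers, let $0<t\le\frac1r$, let $\Delta_n$ be a knot sequence on $[0,1]$ as in the context, and let $S_{\Delta_n,k}$ be the associated Schoenberg operator. Then there exists a constant $M>0$ such that for all $f\in C([0,1])$ $$M\cdot\omega_r(f,t)\le\|f-S_{\Delta_n,k}f\|_\infty.$$
   Context: $C([0,1])$ is the Banach space of real-valued continuous functions on $[0,1]$ with the uniform norm $\|\cdot\|_\infty$. Knots: for integers $n,k>0$, $\Delta_n=\{x_j\}_{j=-k}^{n+k}$ satisfies $x_{-k}=\cdots=x_0=0<x_1<\cdots<x_n=\cdots=x_{n+k}=1$. Normalized B-splines of degree $k$: for $-k\le j\le n-1$, $N_{j,k}(x)=(x_{j+k+1}-x_j)\,[x_j,\ldots,x_{j+k+1}](\cdot-x)_+^k$, where $y_+^k=y^k$ for $y>0$ and $0$ for $y\le0$, and $[x_j,\ldots,x_{j+k+1}]g$ is the divided difference, i.e. the leading coefficient (of degree $k+1$) of the polynomial of degree at most $k+1$ interpolating $g$ at $x_j,\ldots,x_{j+k+1}$ (Hermite interpolation at repeated points); the value at $x=0$ is the right limit. Greville nodes: $\xi_{j,k}=\frac{x_{j+1}+\cdots+x_{j+k}}{k}$, $-k\le j\le n-1$. Schoenberg operator: $S_{\Delta_n,k}f(x)=\sum_{j=-k}^{n-1}f(\xi_{j,k})N_{j,k}(x)$ for $0\le x<1$, and $S_{\Delta_n,k}f(1)=\lim_{y\nearrow1}S_{\Delta_n,k}f(y)$. $r$-th modulus of smoothness, for $0<t\le\frac1r$: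 $\omega_r(f,t)=\sup_{0<h<t}\sup\{|\Delta_h^rf(x)| : x\in[0,1-rh]\}$, where $\Delta_h^rf(x)=\sum_{l=0}^r(-1)^{r-l}\binom rl f(x+lh)$. *)

theory Defs
  imports "HOL-Analysis.Analysis" "HOL-Computational_Algebra.Polynomial"
begin

text \<open>Knot sequences are functions on \<^typ>\<open>int\<close>, of which only the indices
  \<open>-k, \<dots>, n + k\<close> matter: \<open>x\<^sub>-\<^sub>k = \<dots> = x\<^sub>0 = 0 < x\<^sub>1 < \<dots> < x\<^sub>n = \<dots> = x\<^sub>n\<^sub>+\<^sub>k = 1\<close>.\<close>

definition knot_sequence :: "nat \<Rightarrow> nat \<Rightarrow> (int \<Rightarrow> real) \<Rightarrow> bool" where
  "knot_sequence n k x \<longleftrightarrow>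
     (\<forall>j\<in>{- int k..0}. x j = 0) \<and>
     strict_mono_on {0..int n} x \<and>
     (\<forall>j\<in>{int n..int n + int k}. x j = 1)"

text \<open>A point occurring \<open>m\<close> times in \<open>xs\<close> prescribes the derivatives of orders \<open>0, \<dots>, m - 1\<close>.
  This is only meaningful if \<open>g\<close> has these derivatives there (\<^const>\<open>deriv\<close> is unspecified
  otherwise).\<close>

definition hermite_interpolates :: "real poly \<Rightarrow> (real \<Rightarrow> real) \<Rightarrow> real list \<Rightarrow> bool" where
  "hermite_interpolates p g xs \<longleftrightarrow>
     (\<forall>z\<in>set xs. \<forall>i<count_list xs z. poly ((pderiv ^^ i) p) z = (deriv ^^ i) g z)"

definition divided_difference :: "real list \<Rightarrow> (real \<Rightarrow> real) \<Rightarrow> real" where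
  "divided_difference xs g =
     coeff (THE p. degree p \<le> length xs - 1 \<and> hermite_interpolates p g xs) (length xs - 1)"

definition trunc_power :: "nat \<Rightarrow> real \<Rightarrow> real" where
  "trunc_power k y = (if y > 0 then y ^ k else 0)"

definition bspline_formula :: "(int \<Rightarrow> real) \<Rightarrow> nat \<Rightarrow> int \<Rightarrow> real \<Rightarrow> real" where
  "bspline_formula x k j y =
     (x (j + int k + 1) - x j) *
     divided_difference (map x [j..j + int k + 1]) (\<lambda>u. trunc_power k (u - y))"

text \<open>At \<open>y = 0\<close> the formula can involve the \<open>k\<close>-th derivative of \<open>u\<^sub>+\<^sup>k\<close> at the knot \<open>0\<close> of
  multiplicity \<open>k + 1\<close>, which does not exist; the value there is the right limit. The same
  happens at \<open>y = 1\<close>, where the B-splines are not used, see \<open>schoenberg\<close>.\<close>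

definition bspline :: "(int \<Rightarrow> real) \<Rightarrow> nat \<Rightarrow> int \<Rightarrow> real \<Rightarrow> real" where
  "bspline x k j y =
     (if y = 0 then Lim (at_right 0) (bspline_formula x k j) else bspline_formula x k j y)"

definition greville :: "(int \<Rightarrow> real) \<Rightarrow> nat \<Rightarrow> int \<Rightarrow> real" where
  "greville x k j = (\<Sum>i = j + 1..j + int k. x i) / real k"

definition schoenberg_sum ::
    "nat \<Rightarrow> nat \<Rightarrow> (int \<Rightarrow> real) \<Rightarrow> (real \<Rightarrow> real) \<Rightarrow> real \<Rightarrow> real" where
  "schoenberg_sum n k x f y = (\<Sum>j = - int k..int n - 1. f (greville x k j) * bspline x k j y)"

definition schoenberg ::
    "nat \<Rightarrow> nat \<Rightarrow> (int \<Rightarrow> real) \<Rightarrow> (real \<Rightarrow> real) \<Rightarrow> real \<Rightarrow> real" where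
  "schoenberg n k x f y =
     (if y = 1 then Lim (at_left 1) (schoenberg_sum n k x f) else schoenberg_sum n k x f y)"

definition forward_difference :: "nat \<Rightarrow> real \<Rightarrow> (real \<Rightarrow> real) \<Rightarrow> real \<Rightarrow> real" where
  "forward_difference r h f x =
     (\<Sum>l = 0..r. (-1) ^ (r - l) * real (r choose l) * f (x + real l * h))"

definition modulus_of_smoothness :: "nat \<Rightarrow> (real \<Rightarrow> real) \<Rightarrow> real \<Rightarrow> real" where
  "modulus_of_smoothness r f t =
     (SUP h\<in>{0<..<t}. SUP x\<in>{0..1 - real r * h}. \<bar>forward_difference r h f x\<bar>)"

definition uniform_norm :: "(real \<Rightarrow> real) \<Rightarrow> real" where
  "uniform_norm g = (SUP x\<in>{0..1}. \<bar>g x\<bar>)"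

end

theory Submission
  imports Defs
begin

text \<open>The B-splines are nonnegative, sum to 1 and reproduce the identity at the Greville nodes:
  nonnegativity follows from the Cox--de Boor recurrence, the other two by telescoping the
  recurrence for divided differences. So \<open>S f (y)\<close> averages the nodal values of \<open>f\<close> with a
  probability measure of mean \<open>y\<close>, and for \<open>0 < y < 1\<close> this measure is not a point mass; let
  \<open>\<delta> > 0\<close> bound its variance from below at the finitely many interior nodes.

  Given \<open>f\<close>, let \<open>l\<close> be the affine function agreeing with \<open>f\<close> at 0 and 1, and \<open>F = f - l\<close>. Then
  \<open>F - S F = f - S f\<close>, and a discrete maximum principle with barrier \<open>1 - y\<^sup>2\<close> bounds \<open>F\<close> at the
  nodes by \<open>\<parallel>f - S f\<parallel> / \<delta>\<close>. Hence \<open>\<bar>F\<bar> \<le> \<bar>F - S F\<bar> + \<bar>S F\<bar> \<le> (1 + 1 / \<delta>) \<parallel>f - S f\<parallel>\<close>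
  everywhere, and since \<open>r \<ge> 2\<close> the \<open>r\<close>-th differences of \<open>f\<close> and \<open>F\<close> coincide.\<close>

subsection \<open>Hermite interpolation\<close>

text \<open>The data at \<open>z\<close> are given by a polynomial \<open>Q z\<close> with the same Taylor coefficients at \<open>z\<close> as
  the interpolated function, which turns the conditions on derivatives into divisibility.\<close>

definition germ_interpolates :: "(real \<Rightarrow> real poly) \<Rightarrow> real list \<Rightarrow> real poly \<Rightarrow> bool" where
  "germ_interpolates Q xs p \<longleftrightarrow> (\<forall>z. [:- z, 1:] ^ count_list xs z dvd p - Q z)"

definition germ_divided_difference :: "(real \<Rightarrow> real poly) \<Rightarrow> real list \<Rightarrow> real" where
  "germ_divided_difference Q xs =
     coeff (THE p. degree p < length xs \<and> germ_interpolates Q xs p) (length xs - 1)"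

section \<open>Existence and uniqueness of Hermite interpolants\<close>

definition nodal_poly :: "real list \<Rightarrow> real poly" where
  "nodal_poly xs = (\<Prod>z\<leftarrow>xs. [:- z, 1:])"

lemma nodal_poly_simps [simp]:
  "nodal_poly [] = 1"
  "nodal_poly (z # xs) = [:- z, 1:] * nodal_poly xs"
  "nodal_poly (xs @ ys) = nodal_poly xs * nodal_poly ys"
  by (simp_all add: nodal_poly_def)

lemma nodal_poly_neq_0 [simp]: "nodal_poly xs \<noteq> 0"
  by (induction xs) (auto simp del: mult_pCons_left)

lemma degree_nodal_poly [simp]: "degree (nodal_poly xs) = length xs"
  by (induction xs) (auto simp: degree_mult_eq simp del: mult_pCons_left)

lemma lead_coeff_nodal_poly [simp]: "coeff (nodal_poly xs) (length xs) = 1"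
proof -
  have "lead_coeff (nodal_poly xs) = 1"
    by (induction xs) (auto simp: lead_coeff_mult simp del: mult_pCons_left degree_nodal_poly)
  then show ?thesis by simp
qed

text \<open>The nonvanishing cofactor expresses that the multiplicity of \<open>z\<close> is exact;
  it makes one more condition at \<open>z\<close> solvable when \<open>z\<close> is added as a
  node.\<close>

lemma nodal_poly_factor:
  obtains R where "nodal_poly xs = [:- z, 1:] ^ count_list xs z * R" "poly R z \<noteq> 0"
proof -
  have "\<exists>R. nodal_poly xs = [:- z, 1:] ^ count_list xs z * R \<and> poly R z \<noteq> 0"
  proof (induction xs)
    case Nil
    show ?case by (intro exI[of _ 1]) simp
  next
    case (Cons a xs)
    then obtain R where R: "nodal_poly xs = [:- z, 1:] ^ count_list xs z * R" "poly R z \<noteq> 0"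
      by blast
    show ?case
    proof (cases "a = z")
      case True
      with R show ?thesis
        by (intro exI[of _ R]) (simp del: mult_pCons_left add: mult.assoc)
    next
      case False
      with R show ?thesis
        by (intro exI[of _ "[:- a, 1:] * R"]) (simp del: mult_pCons_left add: mult.left_commute)
    qed
  qed
  with that show ?thesis by blast
qed

text \<open>Powers of linear factors at distinct nodes are coprime. The induction cancels
  \<open>[:- a, 1:]\<close>, which lowers the order at \<open>a\<close> by one and leaves it
  unchanged elsewhere.\<close>

lemma nodal_poly_dvd:
  assumes "\<And>z. [:- z, 1:] ^ count_list xs z dvd p"
  shows "nodal_poly xs dvd p"
  using assms
proof (induction xs arbitrary: p)
  case Nil
  then show ?case by simp
next
  case (Cons a xs)
  have "[:- a, 1:] dvd p"
    using Cons.prems[of a] by (simp del: mult_pCons_left) (metis dvd_mult_left)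
  then obtain q where q: "p = [:- a, 1:] * q" by blast
  have "[:- z, 1:] ^ count_list xs z dvd q" for z
  proof (cases "z = a")
    case True
    have "[:- a, 1:] * [:- a, 1:] ^ count_list xs a dvd [:- a, 1:] * q"
      using Cons.prems[of a] by (simp add: q del: mult_pCons_left)
    then show ?thesis
      unfolding True by (subst (asm) dvd_mult_cancel_left) simp
  next
    case False
    have "[:- z, 1:] ^ count_list xs z dvd [:- a, 1:] * q"
      using Cons.prems[of z] False by (simp add: q del: mult_pCons_left)
    then have "q = 0 \<or> count_list xs z \<le> order z ([:- a, 1:] * q)"
      by (auto simp: order_divides simp del: mult_pCons_left)
    moreover have "order z [:- a, 1:] = 0"
      using False by (intro order_0I) auto
    ultimately show ?thesis
      by (cases "q = 0") (auto simp: order_divides order_mult simp del: mult_pCons_left)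
  qed
  from Cons.IH[OF this] show ?case
    unfolding q nodal_poly_simps by (rule mult_dvd_mono[OF dvd_refl])
qed

text \<open>The difference of two interpolants is a multiple of the nodal polynomial, whose degree
  \<open>length xs\<close> is too large unless the difference is 0.\<close>

lemma germ_interpolates_unique:
  assumes "germ_interpolates Q xs p" "germ_interpolates Q xs q"
    and "degree p < length xs" "degree q < length xs"
  shows "p = q"
proof (rule ccontr)
  assume "p \<noteq> q"
  have "[:- z, 1:] ^ count_list xs z dvd p - q" for z
    using dvd_diff[of "[:- z, 1:] ^ count_list xs z" "p - Q z" "q - Q z"] assms(1,2)
    by (simp add: germ_interpolates_def)
  then have "nodal_poly xs dvd p - q" by (rule nodal_poly_dvd)
  then have "length xs \<le> degree (p - q)"
    using \<open>p \<noteq> q\<close> dvd_imp_degree_le[of "nodal_poly xs" "p - q"] by simp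
  then show False
    using degree_diff_less[OF assms(3,4)] by simp
qed

lemma germ_interpolates_sublist:
  assumes "germ_interpolates Q xs p" "\<And>z. count_list ys z \<le> count_list xs z"
  shows "germ_interpolates Q ys p"
  using assms unfolding germ_interpolates_def by (meson dvd_trans le_imp_power_dvd)

lemma germ_interpolates_add_nodal:
  assumes "germ_interpolates Q xs p"
  shows "germ_interpolates Q xs (p + smult c (nodal_poly xs))"
  unfolding germ_interpolates_def
proof
  fix z
  obtain R where "nodal_poly xs = [:- z, 1:] ^ count_list xs z * R"
    using nodal_poly_factor by blast
  then have "[:- z, 1:] ^ count_list xs z dvd (p - Q z) + smult c (nodal_poly xs)"
    using assms by (intro dvd_add dvd_smult) (auto simp: germ_interpolates_def)
  then show "[:- z, 1:] ^ count_list xs z dvd p + smult c (nodal_poly xs) - Q z"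
    by (simp add: algebra_simps)
qed

text \<open>Newton's construction: a multiple of the nodal polynomial of the old nodes corrects the
  next Taylor coefficient at the new node without disturbing earlier conditions. The disjunct
  \<open>p = 0\<close> covers the empty list, for which no degree is small enough.\<close>

lemma germ_interpolates_exists: "\<exists>p. (p = 0 \<or> degree p < length xs) \<and> germ_interpolates Q xs p"
proof (induction xs)
  case Nil
  show ?case by (auto simp: germ_interpolates_def)
next
  case (Cons a xs)
  then obtain p where p: "p = 0 \<or> degree p < length xs" "germ_interpolates Q xs p" by blast
  obtain R where R: "nodal_poly xs = [:- a, 1:] ^ count_list xs a * R" "poly R a \<noteq> 0"
    using nodal_poly_factor by blast
  obtain s where s: "p - Q a = [:- a, 1:] ^ count_list xs a * s"
    using p(2) unfolding germ_interpolates_def by blast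
  \<comment> \<open>This value makes \<open>s + smult c R\<close> vanish at \<open>a\<close>, which
    gains one more factor \<open>[:- a, 1:]\<close>.\<close>
  define c where "c = - poly s a / poly R a"
  define p' where "p' = p + smult c (nodal_poly xs)"
  have "[:- a, 1:] dvd s + smult c R"
    using R(2) by (simp add: c_def poly_eq_0_iff_dvd[symmetric])
  then have "[:- a, 1:] ^ count_list xs a * [:- a, 1:] dvd [:- a, 1:] ^ count_list xs a * (s + smult c R)"
    by (rule mult_dvd_mono[OF dvd_refl])
  also have "[:- a, 1:] ^ count_list xs a * (s + smult c R) = p' - Q a"
    using s R(1) by (simp add: p'_def algebra_simps)
  finally have a: "[:- a, 1:] ^ count_list (a # xs) a dvd p' - Q a"
    by (simp add: mult.commute del: mult_pCons_left mult_pCons_right)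
  have "germ_interpolates Q xs p'"
    unfolding p'_def by (rule germ_interpolates_add_nodal[OF p(2)])
  with a have "germ_interpolates Q (a # xs) p'"
    unfolding germ_interpolates_def by (metis count_list.simps(2))
  moreover have "degree p' \<le> length xs"
    unfolding p'_def using p(1) by (intro degree_add_le) (auto intro: order.trans[OF degree_smult_le])
  ultimately show ?case by (intro exI[of _ p']) auto
qed

lemma germ_divided_difference_eqI:
  assumes "germ_interpolates Q xs p" "degree p < length xs"
  shows "germ_divided_difference Q xs = coeff p (length xs - 1)"
proof -
  have "(THE p. degree p < length xs \<and> germ_interpolates Q xs p) = p"
    using assms germ_interpolates_unique by (intro the_equality) blast+
  then show ?thesis by (simp add: germ_divided_difference_def)
qed

lemma germ_interpolates_obtain:
  assumes "xs \<noteq> []"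
  obtains p where "germ_interpolates Q xs p" "degree p < length xs"
    "coeff p (length xs - 1) = germ_divided_difference Q xs"
proof -
  obtain p where p: "p = 0 \<or> degree p < length xs" "germ_interpolates Q xs p"
    using germ_interpolates_exists by blast
  from p(1) assms have "degree p < length xs" by auto
  with p(2) that germ_divided_difference_eqI show ?thesis by metis
qed

text \<open>One node is dropped, at any position: a multiple of the nodal polynomial of the others
  cancels the top term of \<open>p\<close> and preserves the remaining conditions.\<close>

lemma germ_interpolates_newton:
  assumes p: "germ_interpolates Q xs p" "degree p < length xs"
    and len: "length xs = Suc (length ys)" and sub: "\<And>z. count_list ys z \<le> count_list xs z"
  defines "q \<equiv> p - smult (germ_divided_difference Q xs) (nodal_poly ys)"
  shows "germ_interpolates Q ys q" "ys \<noteq> [] \<Longrightarrow> degree q < length ys"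
    "ys \<noteq> [] \<Longrightarrow> coeff q (length ys - 1) = germ_divided_difference Q ys"
proof -
  let ?c = "germ_divided_difference Q xs"
  have c: "coeff p (length ys) = ?c"
    using germ_divided_difference_eqI[OF p] len by simp
  have "germ_interpolates Q ys (p + smult (- ?c) (nodal_poly ys))"
    using germ_interpolates_sublist[OF p(1) sub] by (rule germ_interpolates_add_nodal)
  then show q: "germ_interpolates Q ys q" by (simp add: q_def)
  show d: "degree q < length ys" if "ys \<noteq> []"
  proof -
    have "coeff q i = 0" if "i \<ge> length ys" for i
    proof (cases "i = length ys")
      case True
      then show ?thesis by (simp add: q_def c)
    next
      case False
      with that len p(2) show ?thesis by (simp add: q_def coeff_eq_0)
    qed
    then have "degree q \<le> length ys - 1" using that by (intro degree_le) auto
    with that show ?thesis by (cases ys) auto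
  qed
  show "coeff q (length ys - 1) = germ_divided_difference Q ys" if "ys \<noteq> []"
    using germ_divided_difference_eqI[OF q d[OF that]] by simp
qed

text \<open>The last and the first node are dropped from the same interpolant, and the coefficients
  of degree \<open>length ys\<close> are compared. The product form with \<open>b - a\<close>
  includes coinciding nodes.\<close>

lemma germ_divided_difference_recurrence:
  "(b - a) * germ_divided_difference Q (a # ys @ [b]) =
    germ_divided_difference Q (ys @ [b]) - germ_divided_difference Q (a # ys)"
proof -
  let ?c = "germ_divided_difference Q (a # ys @ [b])"
  obtain p where p: "germ_interpolates Q (a # ys @ [b]) p" "degree p < length (a # ys @ [b])"
    using germ_interpolates_obtain[of "a # ys @ [b]"] by blast
  have 1: "coeff (p - smult ?c (nodal_poly (a # ys))) (length ys) = germ_divided_difference Q (a # ys)"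
    using germ_interpolates_newton(3)[OF p, of "a # ys"] by simp
  have 2: "coeff (p - smult ?c (nodal_poly (ys @ [b]))) (length ys) = germ_divided_difference Q (ys @ [b])"
    using germ_interpolates_newton(3)[OF p, of "ys @ [b]"] by simp
  have "nodal_poly (a # ys) - nodal_poly (ys @ [b]) = smult (b - a) (nodal_poly ys)"
    by (rule poly_ext) (simp add: algebra_simps)
  then have "coeff (nodal_poly (a # ys)) (length ys) - coeff (nodal_poly (ys @ [b])) (length ys) = b - a"
    by (metis coeff_diff coeff_smult lead_coeff_nodal_poly mult.right_neutral)
  then have "(b - a) * ?c = ?c * coeff (nodal_poly (a # ys)) (length ys) - ?c * coeff (nodal_poly (ys @ [b])) (length ys)"
    by (simp add: algebra_simps flip: right_diff_distrib)
  with 1 2 show ?thesis by (simp only: coeff_diff coeff_smult)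
qed

text \<open>This is the Leibniz rule for a linear factor. The product \<open>[:- y, 1:] * p\<close>
  has the right data but possibly a degree one too large, which a multiple of the nodal polynomial
  repairs.\<close>

lemma germ_divided_difference_times_linear:
  assumes "ys \<noteq> []"
  shows "germ_divided_difference (\<lambda>z. [:- y, 1:] * Q z) (a # ys) =
    (a - y) * germ_divided_difference Q (a # ys) + germ_divided_difference Q ys"
proof -
  let ?Q = "\<lambda>z. [:- y, 1:] * Q z" and ?c = "germ_divided_difference Q (a # ys)"
  obtain p where p: "germ_interpolates Q (a # ys) p" "degree p < length (a # ys)"
    using germ_interpolates_obtain[of "a # ys"] by blast
  define q where "q = p - smult ?c (nodal_poly ys)"
  have q: "degree q < length ys" "coeff q (length ys - 1) = germ_divided_difference Q ys"
    using germ_interpolates_newton[OF p, of ys] assms by (auto simp: q_def)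
  \<comment> \<open>This form shows the degree and the top coefficient; the form proved next shows
    the interpolation property.\<close>
  define P where "P = [:- y, 1:] * q + smult (?c * (a - y)) (nodal_poly ys)"
  have P: "P = [:- y, 1:] * p + smult (- ?c) (nodal_poly (a # ys))"
    by (rule poly_ext) (simp add: P_def q_def algebra_simps)
  have "germ_interpolates ?Q (a # ys) ([:- y, 1:] * p)"
    unfolding germ_interpolates_def right_diff_distrib[symmetric]
    using p(1) by (auto simp: germ_interpolates_def simp del: mult_pCons_left intro!: dvd_mult)
  then have "germ_interpolates ?Q (a # ys) P"
    unfolding P by (rule germ_interpolates_add_nodal)
  moreover have "degree P \<le> length ys"
    unfolding P_def
  proof (rule degree_add_le)
    show "degree ([:- y, 1:] * q) \<le> length ys"
      using degree_mult_le[of "[:- y, 1:]" q] q(1) by simp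
  qed (auto intro: order.trans[OF degree_smult_le])
  ultimately have "germ_divided_difference ?Q (a # ys) = coeff P (length ys)"
    by (subst germ_divided_difference_eqI) auto
  also have "coeff P (length ys) = coeff q (length ys - 1) + ?c * (a - y)"
    using assms q(1) by (cases ys) (simp_all add: P_def coeff_eq_0 del: nodal_poly_simps,
        metis lead_coeff_nodal_poly length_Cons)
  finally show ?thesis using q(2) by simp
qed

section \<open>From conditions on derivatives to divisibility\<close>

lemma power_dvd_iff_pderiv:
  fixes p :: "real poly"
  shows "[:- z, 1:] ^ m dvd p \<longleftrightarrow> (\<forall>i<m. poly ((pderiv ^^ i) p) z = 0)"
proof (induction m arbitrary: p)
  case 0
  then show ?case by simp
next
  case (Suc m)
  have "(\<forall>i<Suc m. poly ((pderiv ^^ i) p) z = 0) \<longleftrightarrow>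
      poly p z = 0 \<and> [:- z, 1:] ^ m dvd pderiv p"
    unfolding Suc by (simp add: All_less_Suc2 funpow_Suc_right del: funpow.simps(2))
  also have "\<dots> \<longleftrightarrow> [:- z, 1:] ^ Suc m dvd p"
  proof (cases "poly p z = 0 \<and> p \<noteq> 0")
    case True
    \<comment> \<open>Differentiation lowers the order of a root by exactly one.\<close>
    then have "order z p \<noteq> 0" using order_root[of p z] by blast
    moreover have "pderiv p \<noteq> 0"
      using True by (auto dest: pderiv_iszero)
    ultimately show ?thesis
      using True order_pderiv[of p z] by (simp add: order_divides del: power_Suc)
  next
    case False
    then show ?thesis
      by (auto simp: order_divides order_root simp del: power_Suc)
  qed
  finally show ?case by simp
qed

text \<open>Equality on a neighbourhood, not merely at \<open>z\<close>, is what the induction can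
  differentiate.\<close>

lemma higher_deriv_poly:
  assumes "\<forall>\<^sub>F u in nhds z. g u = poly q u"
  shows "\<forall>\<^sub>F u in nhds z. (deriv ^^ i) g u = poly ((pderiv ^^ i) q) u"
proof (induction i)
  case 0
  then show ?case using assms by simp
next
  case (Suc i)
  then have "\<forall>\<^sub>F u in nhds z. \<forall>\<^sub>F v in nhds u. (deriv ^^ i) g v = poly ((pderiv ^^ i) q) v"
    by (simp add: eventually_eventually)
  then show ?case
  proof eventually_elim
    case (elim u)
    then have "deriv ((deriv ^^ i) g) u = deriv (poly ((pderiv ^^ i) q)) u"
      by (intro deriv_cong_ev) auto
    also have "\<dots> = poly (pderiv ((pderiv ^^ i) q)) u"
      by (intro DERIV_imp_deriv poly_DERIV)
    finally show ?case by simp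
  qed
qed

lemma pderiv_funpow_diff: "(pderiv ^^ i) (p - q) = (pderiv ^^ i) p - (pderiv ^^ i) q"
  for p q :: "real poly"
  by (induction i) (simp_all add: pderiv_diff)

text \<open>Only the derivatives prescribed by the multiplicity of \<open>z\<close> have to match
  \<open>Q z\<close>, so a function that is not smooth at a node can still be treated.\<close>

lemma divided_difference_eq_germ:
  assumes "xs \<noteq> []"
    and "\<And>z i. z \<in> set xs \<Longrightarrow> i < count_list xs z \<Longrightarrow> (deriv ^^ i) g z = poly ((pderiv ^^ i) (Q z)) z"
  shows "divided_difference xs g = germ_divided_difference Q xs"
proof -
  have "hermite_interpolates p g xs \<longleftrightarrow> germ_interpolates Q xs p" for p
  proof -
    have "hermite_interpolates p g xs \<longleftrightarrow>
        (\<forall>z\<in>set xs. \<forall>i<count_list xs z. poly ((pderiv ^^ i) (p - Q z)) z = 0)"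
      using assms(2) by (simp add: hermite_interpolates_def pderiv_funpow_diff)
    also have "\<dots> \<longleftrightarrow> (\<forall>z. [:- z, 1:] ^ count_list xs z dvd p - Q z)"
      unfolding power_dvd_iff_pderiv by (metis count_list_0_iff not_less_zero)
    finally show ?thesis by (simp add: germ_interpolates_def)
  qed
  moreover have "d \<le> length xs - 1 \<longleftrightarrow> d < length xs" for d :: nat
    using assms(1) by (cases xs) auto
  ultimately show ?thesis
    by (simp add: divided_difference_def germ_divided_difference_def)
qed

subsection \<open>Divided differences of truncated powers\<close>

text \<open>The local data of \<open>u \<mapsto> (u - y)\<^sub>+\<^sup>k\<close>. At \<open>z = y\<close> the left germ is chosen, which makes the
  splines of degree 0 right continuous; for \<open>k > 0\<close> and a simple knot both germs prescribe the
  value 0.\<close>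

definition trunc_power_germ :: "nat \<Rightarrow> real \<Rightarrow> real \<Rightarrow> real poly" where
  "trunc_power_germ k y z = (if z \<le> y then 0 else [:- y, 1:] ^ k)"

lemma trunc_power_germ_Suc:
  "trunc_power_germ (Suc k) y = (\<lambda>z. [:- y, 1:] * trunc_power_germ k y z)"
  by (auto simp: trunc_power_germ_def fun_eq_iff)

lemma germ_interpolates_cong:
  assumes "\<And>z. z \<in> set xs \<Longrightarrow> Q z = Q' z"
  shows "germ_interpolates Q xs p \<longleftrightarrow> germ_interpolates Q' xs p"
proof -
  have "[:- z, 1:] ^ count_list xs z dvd p - Q z \<longleftrightarrow> [:- z, 1:] ^ count_list xs z dvd p - Q' z" for z
    using assms[of z] by (cases "z \<in> set xs") (simp_all add: count_notin)
  then show ?thesis by (simp add: germ_interpolates_def)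
qed

lemma germ_interpolates_const: "germ_interpolates (\<lambda>_. p) xs p"
  by (simp add: germ_interpolates_def)

lemma germ_divided_difference_trunc_left:
  assumes "xs \<noteq> []" "\<And>z. z \<in> set xs \<Longrightarrow> z \<le> y"
  shows "germ_divided_difference (trunc_power_germ k y) xs = 0"
proof -
  have "germ_interpolates (trunc_power_germ k y) xs 0"
    using assms(2) germ_interpolates_const[of 0]
    by (subst germ_interpolates_cong[of _ _ "\<lambda>_. 0"]) (auto simp: trunc_power_germ_def)
  from germ_divided_difference_eqI[OF this] assms(1) show ?thesis by simp
qed

lemma degree_linear_power_monic [simp]: "degree ([:a, 1:] ^ k) = k" for a :: real
  by (simp add: degree_power_eq)

lemma lead_coeff_linear_power_monic [simp]: "coeff ([:a, 1:] ^ k) k = 1" for a :: real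
  using lead_coeff_power[of "[:a, 1:]" k] by simp

lemma germ_divided_difference_trunc_right:
  assumes "k < length xs" "\<And>z. z \<in> set xs \<Longrightarrow> y < z"
  shows "germ_divided_difference (trunc_power_germ k y) xs = (if length xs = Suc k then 1 else 0)"
proof -
  have "germ_interpolates (trunc_power_germ k y) xs ([:- y, 1:] ^ k)"
    using assms(2) germ_interpolates_const[of "[:- y, 1:] ^ k"]
    by (subst germ_interpolates_cong[of _ _ "\<lambda>_. [:- y, 1:] ^ k"]) (force simp: trunc_power_germ_def)+
  from germ_divided_difference_eqI[OF this] assms(1) show ?thesis
    by (auto simp: coeff_eq_0)
qed

text \<open>Here the degree equals the number of nodes, and the value is the complete homogeneous
  polynomial of degree 1 in the numbers \<open>z - y\<close>. It supplies the boundary term for the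
  mean of the B-splines. Nodes are peeled off by the Leibniz rule.\<close>

lemma germ_divided_difference_trunc_right_sum:
  assumes "xs \<noteq> []" "\<And>z. z \<in> set xs \<Longrightarrow> y < z"
  shows "germ_divided_difference (trunc_power_germ (length xs) y) xs = (\<Sum>z\<leftarrow>xs. z - y)"
  using assms
proof (induction xs)
  case (Cons a xs)
  show ?case
  proof (cases "xs = []")
    case True
    have "[:- a, 1:] dvd [:a - y:] - [:- y, 1:]"
      by (simp add: poly_eq_0_iff_dvd[symmetric])
    then have "germ_interpolates (trunc_power_germ 1 y) [a] [:a - y:]"
      using Cons.prems(2)[of a] by (simp add: germ_interpolates_def trunc_power_germ_def)
    from germ_divided_difference_eqI[OF this] True show ?thesis by simp
  next
    case False
    have "germ_divided_difference (trunc_power_germ (length xs) y) (a # xs) = 1"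
      using Cons.prems(2) by (subst germ_divided_difference_trunc_right) auto
    with False show ?thesis
      using Cons by (simp add: trunc_power_germ_Suc germ_divided_difference_times_linear
          del: mult_pCons_left)
  qed
qed simp

section \<open>Divided differences over ranges of knots: recurrence, support, sign and
  limits\<close>

definition spline_dd :: "(int \<Rightarrow> real) \<Rightarrow> nat \<Rightarrow> int \<Rightarrow> int \<Rightarrow> real \<Rightarrow> real" where
  "spline_dd x k i l y = germ_divided_difference (trunc_power_germ k y) (map x [i..l])"

lemma spline_dd_left:
  assumes "i \<le> l" "\<And>a. a \<in> {i..l} \<Longrightarrow> x a \<le> y"
  shows "spline_dd x k i l y = 0"
  unfolding spline_dd_def using assms by (intro germ_divided_difference_trunc_left) auto

lemma spline_dd_right:
  assumes "i + int k \<le> l" "\<And>a. a \<in> {i..l} \<Longrightarrow> y < x a"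
  shows "spline_dd x k i l y = (if l = i + int k then 1 else 0)"
  unfolding spline_dd_def using assms by (subst germ_divided_difference_trunc_right) auto

lemma spline_dd_recurrence:
  assumes "i < l"
  shows "(x l - x i) * spline_dd x k i l y = spline_dd x k (i + 1) l y - spline_dd x k i (l - 1) y"
proof -
  have "map x [i..l] = x i # map x [i + 1..l - 1] @ [x l]"
    "map x [i + 1..l] = map x [i + 1..l - 1] @ [x l]"
    "map x [i..l - 1] = x i # map x [i + 1..l - 1]"
    using assms by (simp_all add: upto_rec1[of i] upto_rec2[of "i + 1" l])
  then show ?thesis
    unfolding spline_dd_def by (metis germ_divided_difference_recurrence)
qed

lemma spline_dd_Suc:
  assumes "i < l"
  shows "spline_dd x (Suc k) i l y = (x i - y) * spline_dd x k i l y + spline_dd x k (i + 1) l y"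
  using assms
  by (simp add: spline_dd_def trunc_power_germ_Suc germ_divided_difference_times_linear upto_rec1[of i]
      del: mult_pCons_left)

text \<open>The Leibniz rule splits off one factor \<open>u - y\<close>, and the recurrence for
  divided differences removes the term over the full range. No division occurs, so coinciding knots
  are included.\<close>

lemma cox_de_boor:
  assumes "i < l"
  shows "(x l - x i) * spline_dd x (Suc k) i l y =
    (y - x i) * spline_dd x k i (l - 1) y + (x l - y) * spline_dd x k (i + 1) l y"
proof -
  have "(x l - x i) * spline_dd x (Suc k) i l y =
     (x i - y) * ((x l - x i) * spline_dd x k i l y) + (x l - x i) * spline_dd x k (i + 1) l y"
    unfolding spline_dd_Suc[OF assms] by (simp add: algebra_simps)
  also have "\<dots> = (y - x i) * spline_dd x k i (l - 1) y + (x l - y) * spline_dd x k (i + 1) l y"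
    unfolding spline_dd_recurrence[OF assms] by (simp add: algebra_simps)
  finally show ?thesis .
qed

text \<open>If all knots exceed \<open>y\<close>, the truncated power is a polynomial of degree
  \<open>m\<close> on \<open>m + 2\<close> nodes; if none does, it is 0. By the half-open convention
  every \<open>y\<close> is outside when the end knots coincide.\<close>

lemma spline_dd_outside:
  assumes "mono_on {a..b} x" "a \<le> j" "j + int m + 1 \<le> b" "y < x j \<or> x (j + int m + 1) \<le> y"
  shows "spline_dd x m j (j + int m + 1) y = 0"
  using assms(4)
proof
  assume "y < x j"
  moreover have "x j \<le> x i" if "i \<in> {j..j + int m + 1}" for i
    using assms(1-3) that by (intro mono_onD[OF assms(1)]) auto
  ultimately show ?thesis by (subst spline_dd_right) (auto intro: less_le_trans)
next
  assume "x (j + int m + 1) \<le> y"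
  moreover have "x i \<le> x (j + int m + 1)" if "i \<in> {j..j + int m + 1}" for i
    using assms(1-3) that by (intro mono_onD[OF assms(1)]) auto
  ultimately show ?thesis by (intro spline_dd_left) (auto intro: order.trans)
qed

lemma spline_dd_0:
  "(x (j + 1) - x j) * spline_dd x 0 j (j + 1) y = of_bool (y < x (j + 1)) - of_bool (y < x j)"
proof -
  have "spline_dd x 0 i i y = of_bool (y < x i)" for i
    using spline_dd_left[of i i x y 0] spline_dd_right[of i 0 i y x] by auto
  then show ?thesis by (subst spline_dd_recurrence) auto
qed

text \<open>Inside the support both Cox--de Boor weights are nonnegative and the end knots are
  distinct, so the factor on the left can be cancelled.\<close>

lemma spline_dd_nonneg:
  assumes "mono_on {a..b} x" "a \<le> j" "j + int m + 1 \<le> b"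
  shows "0 \<le> spline_dd x m j (j + int m + 1) y"
  using assms(2,3)
proof (induction m arbitrary: j)
  case 0
  show ?case
  proof (cases "y < x j \<or> x (j + int 0 + 1) \<le> y")
    case True
    then show ?thesis using spline_dd_outside[OF assms(1) 0] by simp
  next
    case False
    then show ?thesis using spline_dd_0[of x j y] by (auto simp: zero_le_mult_iff) (smt (verit) mult_pos_neg)
  qed
next
  case (Suc m)
  show ?case
  proof (cases "y < x j \<or> x (j + int (Suc m) + 1) \<le> y")
    case True
    then show ?thesis using spline_dd_outside[OF assms(1) Suc.prems] by simp
  next
    case False
    let ?l = "j + int (Suc m) + 1"
    have "0 \<le> (y - x j) * spline_dd x m j (?l - 1) y + (x ?l - y) * spline_dd x m (j + 1) ?l y"
      using False Suc.IH[of j] Suc.IH[of "j + 1"] Suc.prems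
      by (intro add_nonneg_nonneg mult_nonneg_nonneg) (auto simp: algebra_simps)
    then have "0 \<le> (x ?l - x j) * spline_dd x (Suc m) j ?l y"
      by (subst cox_de_boor) auto
    then show ?thesis using False by (auto simp: zero_le_mult_iff)
  qed
qed

text \<open>The recurrence is followed along ranges ending at \<open>m + 1\<close>: the second term
  keeps this end and has a strictly positive weight, and the first is nonnegative.\<close>

lemma spline_dd_pos:
  assumes "mono_on {a..b} x" "a \<le> m - int i" "m + 1 \<le> b" "x m \<le> y" "y < x (m + 1)"
  shows "0 < spline_dd x i (m - int i) (m + 1) y"
  using assms(2)
proof (induction i)
  case 0
  then show ?case
    using assms(4,5) spline_dd_0[of x m y] by (auto simp: zero_less_mult_iff) (smt (verit) mult_nonneg_nonpos)
next
  case (Suc i)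
  let ?j = "m - int (Suc i)"
  have xj: "x ?j \<le> x m"
    using Suc.prems assms(3) by (intro mono_onD[OF assms(1)]) auto
  have "0 \<le> (y - x ?j) * spline_dd x i ?j m y"
    using spline_dd_nonneg[OF assms(1), of ?j i y] Suc.prems assms(3,4) xj by auto
  moreover have "0 < (x (m + 1) - y) * spline_dd x i (?j + 1) (m + 1) y"
    using Suc assms(5) by simp
  ultimately have "0 < (x (m + 1) - x ?j) * spline_dd x (Suc i) ?j (m + 1) y"
    by (subst cox_de_boor) auto
  then show ?case
    using xj assms(4,5) by (auto simp: zero_less_mult_iff)
qed

text \<open>The last condition on \<open>F\<close>, which one-sided neighbourhoods satisfy, makes
  the step functions of degree 0 eventually constant. The Cox--de Boor recurrence carries the limit
  to higher degrees.\<close>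

lemma spline_dd_tendsto:
  assumes "mono_on {a..b} x" "a \<le> j" "j + int m + 1 \<le> b"
    and F: "((\<lambda>y. y) \<longlongrightarrow> c) F" "\<And>z. (\<forall>\<^sub>F y in F. y < z) \<or> (\<forall>\<^sub>F y in F. z \<le> y)"
  shows "\<exists>L. (spline_dd x m j (j + int m + 1) \<longlongrightarrow> L) F"
  using assms(2,3)
proof (induction m arbitrary: j)
  case 0
  show ?case
  proof (cases "x j = x (j + 1)")
    case True
    then have "spline_dd x 0 j (j + int 0 + 1) = (\<lambda>y. 0)"
      by (intro ext spline_dd_outside[OF assms(1) 0]) auto
    then show ?thesis by auto
  next
    case False
    have *: "\<exists>L. ((\<lambda>y. of_bool (y < z) :: real) \<longlongrightarrow> L) F" for z
      using F(2)[of z]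
    proof
      assume "\<forall>\<^sub>F y in F. y < z"
      then show ?thesis by (intro exI[of _ 1] tendsto_eventually) (auto elim: eventually_mono)
    next
      assume "\<forall>\<^sub>F y in F. z \<le> y"
      then show ?thesis by (intro exI[of _ 0] tendsto_eventually) (auto elim: eventually_mono)
    qed
    obtain L M where "((\<lambda>y. of_bool (y < x (j + 1)) :: real) \<longlongrightarrow> L) F" "((\<lambda>y. of_bool (y < x j) :: real) \<longlongrightarrow> M) F"
      using * by meson
    then have "((\<lambda>y. (of_bool (y < x (j + 1)) - of_bool (y < x j)) / (x (j + 1) - x j)) \<longlongrightarrow> (L - M) / (x (j + 1) - x j)) F"
      using False by (intro tendsto_intros) auto
    also have "(\<lambda>y. (of_bool (y < x (j + 1)) - of_bool (y < x j)) / (x (j + 1) - x j)) = spline_dd x 0 j (j + int 0 + 1)"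
      using False by (simp add: fun_eq_iff spline_dd_0[symmetric])
    finally show ?thesis by blast
  qed
next
  case (Suc m)
  let ?l = "j + int (Suc m) + 1"
  show ?case
  proof (cases "x j = x ?l")
    case True
    then have "spline_dd x (Suc m) j ?l = (\<lambda>y. 0)"
      by (intro ext spline_dd_outside[OF assms(1) Suc.prems]) auto
    then show ?thesis by auto
  next
    case False
    obtain L M where "(spline_dd x m j (?l - 1) \<longlongrightarrow> L) F" "(spline_dd x m (j + 1) ?l \<longlongrightarrow> M) F"
      using Suc.IH[of j] Suc.IH[of "j + 1"] Suc.prems by (auto simp: algebra_simps)
    then have "((\<lambda>y. ((y - x j) * spline_dd x m j (?l - 1) y + (x ?l - y) * spline_dd x m (j + 1) ?l y) / (x ?l - x j))
       \<longlongrightarrow> ((c - x j) * L + (x ?l - c) * M) / (x ?l - x j)) F"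
      using False F(1) by (intro tendsto_intros) auto
    also have "(\<lambda>y. ((y - x j) * spline_dd x m j (?l - 1) y + (x ?l - y) * spline_dd x m (j + 1) ?l y) / (x ?l - x j)) =
       spline_dd x (Suc m) j ?l"
      by (rule ext, subst cox_de_boor[symmetric]) (use False in auto)
    finally show ?thesis by blast
  qed
qed

subsection \<open>The Schoenberg operator as an average over the nodes\<close>

lemma sum_telescope_int:
  fixes f :: "int \<Rightarrow> real"
  assumes "a \<le> b"
  shows "(\<Sum>j = a..b - 1. f (j + 1) - f j) = f b - f a"
  using assms
proof (induction b rule: int_ge_induct)
  case (step b)
  have "{a..b + 1 - 1} = insert b {a..b - 1}" using step.hyps by auto
  then show ?case using step.IH by simp
qed simp

locale schoenberg_knots =
  fixes n k :: nat and x :: "int \<Rightarrow> real"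
  assumes n_pos: "n > 0" and k_ge_2: "k \<ge> 2" and knots: "knot_sequence n k x"
begin

lemma knot_left: "- int k \<le> j \<Longrightarrow> j \<le> 0 \<Longrightarrow> x j = 0"
  and knot_right: "int n \<le> j \<Longrightarrow> j \<le> int n + int k \<Longrightarrow> x j = 1"
  using knots by (auto simp: knot_sequence_def)

lemma knot_less: "0 \<le> i \<Longrightarrow> i < j \<Longrightarrow> j \<le> int n \<Longrightarrow> x i < x j"
  using knots by (auto simp: knot_sequence_def strict_mono_on_def)

lemma knot_mono: "mono_on {- int k..int n + int k} x"
proof (rule mono_onI)
  fix i j assume ij: "i \<in> {- int k..int n + int k}" "j \<in> {- int k..int n + int k}" "i \<le> j"
  \<comment> \<open>Clamping an index to the range from 0 to \<open>n\<close> does not change the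
    knot, which reduces the claim to strict monotonicity on that range.\<close>
  have step: "x (max 0 (min (int n) l)) = x l" if "l \<in> {- int k..int n + int k}" for l
    using that knot_left[of l] knot_left[of 0] knot_right[of l] knot_right[of "int n"] n_pos
    by (auto simp: max_def min_def)
  have "x (max 0 (min (int n) i)) \<le> x (max 0 (min (int n) j))"
    using knot_less[of "max 0 (min (int n) i)" "max 0 (min (int n) j)"] ij(3)
    by (cases "max 0 (min (int n) i) = max 0 (min (int n) j)") (auto simp: max_def min_def split: if_splits)
  then show "x i \<le> x j" using step ij by simp
qed

lemma knot_bounds: "j \<in> {- int k..int n + int k} \<Longrightarrow> 0 \<le> x j \<and> x j \<le> 1"
  using mono_onD[OF knot_mono, of "- int k" j] mono_onD[OF knot_mono, of j "int n + int k"]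
    knot_left[of "- int k"] knot_right[of "int n + int k"] by auto

lemma interior_knot_unique:
  assumes "i \<in> {- int k..int n + int k}" "j \<in> {- int k..int n + int k}"
    and "x i = y" "x j = y" "0 < y" "y < 1"
  shows "i = j"
proof -
  have "0 < i \<and> i < int n" "0 < j \<and> j < int n"
    using assms knot_left knot_right by (smt (verit) atLeastAtMost_iff)+
  with assms(3,4) knot_less show ?thesis
    by (metis less_irrefl less_le linorder_cases)
qed

text \<open>Interior knots are simple, so at the kink of a truncated power only the value is ever
  prescribed.\<close>

lemma count_interior_knot_le_1:
  assumes "- int k \<le> i" "l \<le> int n + int k" "0 < y" "y < 1"
  shows "count_list (map x [i..l]) y \<le> 1"
proof -
  have "finite {a \<in> {i..l}. x a = y}"
    by (rule finite_subset[of _ "{i..l}"]) auto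
  note card_le = card_le_Suc0_iff_eq[OF this]
  have "count_list (map x [i..l]) y = card {a \<in> {i..l}. x a = y}"
    by (simp add: count_list_eq_length_filter filter_map comp_def eq_commute
        flip: distinct_card[OF distinct_filter[OF distinct_upto]])
  also have "\<dots> \<le> 1"
    unfolding One_nat_def card_le using assms by (auto intro: interior_knot_unique[of _ _ y])
  finally show ?thesis .
qed

section \<open>B-splines: partition of unity and mean\<close>

definition basis :: "int \<Rightarrow> real \<Rightarrow> real" where
  "basis j y = (x (j + int k + 1) - x j) * spline_dd x k j (j + int k + 1) y"

text \<open>Away from \<open>y\<close> the truncated power is locally a polynomial; at
  \<open>y\<close> only its value 0 is prescribed, on which the chosen germ agrees.\<close>

lemma bspline_formula_eq_basis:
  assumes "- int k \<le> j" "j \<le> int n - 1" "0 < y" "y < 1"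
  shows "bspline_formula x k j y = basis j y"
proof -
  let ?g = "\<lambda>u. trunc_power k (u - y)" and ?xs = "map x [j..j + int k + 1]"
  have "divided_difference ?xs ?g = germ_divided_difference (trunc_power_germ k y) ?xs"
  proof (rule divided_difference_eq_germ)
    fix z i assume "i < count_list ?xs z"
    consider "z < y" | "z = y" | "y < z" by linarith
    then show "(deriv ^^ i) ?g z = poly ((pderiv ^^ i) (trunc_power_germ k y z)) z"
    proof cases
      case 1
      have "\<forall>\<^sub>F u in nhds z. u < y" using 1 by (rule order_tendstoD(2)[OF filterlim_ident])
      then have "\<forall>\<^sub>F u in nhds z. ?g u = poly 0 u"
        by eventually_elim (simp add: trunc_power_def)
      from eventually_nhds_x_imp_x[OF higher_deriv_poly[OF this, of i]] 1 show ?thesis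
        by (simp add: trunc_power_germ_def)
    next
      case 2
      then have "i = 0"
        using \<open>i < count_list ?xs z\<close> count_interior_knot_le_1[of j "j + int k + 1" y] assms by simp
      with 2 show ?thesis by (simp add: trunc_power_def trunc_power_germ_def)
    next
      case 3
      have "\<forall>\<^sub>F u in nhds z. y < u" using 3 by (rule order_tendstoD(1)[OF filterlim_ident])
      then have "\<forall>\<^sub>F u in nhds z. ?g u = poly ([:- y, 1:] ^ k) u"
        by eventually_elim (simp add: trunc_power_def)
      from eventually_nhds_x_imp_x[OF higher_deriv_poly[OF this, of i]] 3 show ?thesis
        by (simp add: trunc_power_germ_def)
    qed
  qed simp
  then show ?thesis by (simp add: bspline_formula_def basis_def spline_dd_def)
qed

lemma basis_nonneg:
  assumes "- int k \<le> j" "j \<le> int n - 1"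
  shows "0 \<le> basis j y"
proof -
  have "x j \<le> x (j + int k + 1)"
    using assms by (intro mono_onD[OF knot_mono]) auto
  moreover have "0 \<le> spline_dd x k j (j + int k + 1) y"
    using assms by (intro spline_dd_nonneg[OF knot_mono]) auto
  ultimately show ?thesis by (simp add: basis_def)
qed

text \<open>The normalizing factor is the one in the recurrence, so sums over \<open>j\<close>
  telescope.\<close>

lemma basis_eq_diff:
  "basis j y = spline_dd x k (j + 1) (j + 1 + int k) y - spline_dd x k j (j + int k) y"
  unfolding basis_def by (subst spline_dd_recurrence) (auto simp: algebra_simps)

lemma spline_dd_all_left:
  assumes "0 < y" "- int k \<le> i" "i \<le> l" "l \<le> 0"
  shows "spline_dd x m i l y = 0"
  using assms knot_left by (intro spline_dd_left) (auto intro: less_imp_le)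

lemma spline_dd_all_right:
  assumes "y < 1"
  shows "spline_dd x k (int n) (int n + int k) y = 1"
    "spline_dd x k (int n) (int n + int k - 1) y = real k * (1 - y)"
proof -
  show "spline_dd x k (int n) (int n + int k) y = 1"
    using assms knot_right by (subst spline_dd_right) auto
  let ?xs = "map x [int n..int n + int k - 1]"
  have xs: "?xs = replicate k 1"
    by (rule nth_equalityI) (auto intro: knot_right)
  have "germ_divided_difference (trunc_power_germ k y) (replicate k 1) = real k * (1 - y)"
    using germ_divided_difference_trunc_right_sum[of "replicate k 1" y] assms k_ge_2
    by (simp add: sum_list_replicate)
  then show "spline_dd x k (int n) (int n + int k - 1) y = real k * (1 - y)"
    unfolding spline_dd_def xs by simp
qed

lemma sum_basis:
  assumes "0 < y" "y < 1"
  shows "(\<Sum>j = - int k..int n - 1. basis j y) = 1"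
proof -
  have "(\<Sum>j = - int k..int n - 1. basis j y) =
      spline_dd x k (int n) (int n + int k) y - spline_dd x k (- int k) (- int k + int k) y"
    unfolding basis_eq_diff by (rule sum_telescope_int[of _ _ "\<lambda>j. spline_dd x k j (j + int k) y"]) simp
  then show ?thesis
    using assms by (simp add: spline_dd_all_left spline_dd_all_right)
qed

text \<open>Summation by parts: the increment of \<open>s\<close> is the factor in the recurrence
  for ranges with one knot fewer, so the correction term telescopes as well, and \<open>T\<close> is
  the resulting antidifference.\<close>

lemma sum_greville_basis:
  assumes "0 < y" "y < 1"
  shows "(\<Sum>j = - int k..int n - 1. greville x k j * basis j y) = y"
proof -
  define s where "s j = (\<Sum>i = j + 1..j + int k. x i)" for j
  define E where "E j = spline_dd x k j (j + int k) y" for j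
  define H where "H j = spline_dd x k j (j + int k - 1) y" for j
  define T where "T j = s (j - 1) * E j - H j" for j
  have s: "s j - s (j - 1) = x (j + int k) - x j" for j
  proof -
    have "{j + 1..j + int k} = insert (j + int k) {j + 1..j + int k - 1}"
      "{j..j + int k - 1} = insert j {j + 1..j + int k - 1}"
      using k_ge_2 by auto
    then have "s j = x (j + int k) + (\<Sum>i = j + 1..j + int k - 1. x i)"
      "s (j - 1) = x j + (\<Sum>i = j + 1..j + int k - 1. x i)"
      by (simp_all add: s_def algebra_simps)
    then show ?thesis by simp
  qed
  have "s j * basis j y = T (j + 1) - T j" for j
  proof -
    have "(s j - s (j - 1)) * E j = H (j + 1) - H j"
      unfolding s E_def H_def using k_ge_2 by (subst spline_dd_recurrence) (auto simp: algebra_simps)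
    moreover have E: "basis j y = E (j + 1) - E j"
      unfolding basis_eq_diff E_def by simp
    ultimately show ?thesis unfolding E by (simp add: T_def algebra_simps)
  qed
  then have "(\<Sum>j = - int k..int n - 1. s j * basis j y) = T (int n) - T (- int k)"
    by (simp add: sum_telescope_int)
  also have "T (- int k) = 0"
    using assms k_ge_2 by (simp add: T_def E_def H_def spline_dd_all_left)
  also have "T (int n) = real k * y"
  proof -
    have "s (int n - 1) = (\<Sum>i = int n..int n + int k - 1. 1)"
      unfolding s_def by (intro sum.cong) (auto intro: knot_right)
    then have "s (int n - 1) = real k" by simp
    then show ?thesis
      unfolding T_def E_def H_def spline_dd_all_right[OF assms(2)] by (simp add: algebra_simps)
  qed
  finally have "(\<Sum>j = - int k..int n - 1. s j * basis j y) = real k * y" by simp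
  moreover have "(\<Sum>j = - int k..int n - 1. greville x k j * basis j y) =
      (\<Sum>j = - int k..int n - 1. s j * basis j y) / real k"
    unfolding sum_divide_distrib[of "\<lambda>j. s j * basis j y"] by (simp add: greville_def s_def)
  ultimately show ?thesis using k_ge_2 by simp
qed

lemma greville_bounds:
  assumes "- int k \<le> j" "j \<le> int n - 1"
  shows "0 \<le> greville x k j" "greville x k j \<le> 1"
proof -
  have "0 \<le> x i \<and> x i \<le> 1" if "i \<in> {j + 1..j + int k}" for i
    using that assms by (intro knot_bounds) auto
  then have "0 \<le> (\<Sum>i = j + 1..j + int k. x i)" "(\<Sum>i = j + 1..j + int k. x i) \<le> (\<Sum>i = j + 1..j + int k. 1)"
    by (auto intro!: sum_nonneg sum_mono simp del: sum_constant)
  then show "0 \<le> greville x k j" "greville x k j \<le> 1"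
    using k_ge_2 by (auto simp: greville_def)
qed

text \<open>If \<open>m\<close> is the index of the last knot not exceeding \<open>y\<close>, the
  B-spline with index \<open>m - k\<close> is positive at \<open>y\<close>, and its node averages
  knots that are all at most \<open>y\<close>, one of them strictly smaller.\<close>

lemma basis_pos_off_node:
  assumes "0 < y" "y < 1"
  shows "\<exists>j\<in>{- int k..int n - 1}. 0 < basis j y \<and> greville x k j \<noteq> y"
proof -
  let ?A = "{i \<in> {0..int n}. x i \<le> y}"
  define m where "m = Max ?A"
  have finite_A: "finite ?A" by (rule finite_subset[of _ "{0..int n}"]) auto
  have "0 \<in> ?A" using knot_left[of 0] assms by auto
  with finite_A have m: "m \<in> ?A" unfolding m_def by (intro Max_in) auto
  have "m \<noteq> int n" using m knot_right[of "int n"] assms by auto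
  with m have mn: "0 \<le> m" "m < int n" "x m \<le> y" by auto
  have "m + 1 \<notin> ?A"
    using Max_ge[OF finite_A, of "m + 1"] by (auto simp: m_def)
  then have xm1: "y < x (m + 1)" using mn by auto
  let ?j = "m - int k"
  have le: "x i \<le> y" if "i \<in> {?j..m}" for i
    using mono_onD[OF knot_mono, of i m] that mn by auto
  have "0 < spline_dd x k ?j (m + 1) y"
    using mn xm1 by (intro spline_dd_pos[OF knot_mono]) auto
  then have "0 < basis ?j y"
    using le[of ?j] xm1 by (simp add: basis_def)
  moreover have "greville x k ?j < y"
  proof -
    \<comment> \<open>For \<open>m > 0\<close>, \<open>k \<ge> 2\<close> puts a knot before
      \<open>x m\<close> among the averaged ones; for \<open>m = 0\<close> they are all 0.\<close>
    have "x (?j + 1) < y"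
    proof (cases "m = 0")
      case True
      then show ?thesis using knot_left[of "?j + 1"] k_ge_2 assms by simp
    next
      case False
      have "x (?j + 1) \<le> x (m - 1)"
        using k_ge_2 mn by (intro mono_onD[OF knot_mono]) auto
      also have "\<dots> < x m" using False mn by (intro knot_less) auto
      finally show ?thesis using mn by simp
    qed
    then have "(\<Sum>i = ?j + 1..m. x i) < (\<Sum>i = ?j + 1..m. y)"
      using k_ge_2 le by (intro sum_strict_mono_ex1) (auto intro!: bexI[of _ "?j + 1"])
    then show ?thesis using k_ge_2 by (simp add: greville_def divide_less_eq mult.commute)
  qed
  ultimately show ?thesis using mn by (intro bexI[of _ ?j]) auto
qed

text \<open>Sign, total mass and mean pass to the limit. This provides the weights at the two
  endpoints.\<close>

lemma basis_limits:
  assumes "F \<noteq> bot" "((\<lambda>y. y) \<longlongrightarrow> c) F" "\<forall>\<^sub>F y in F. 0 < y \<and> y < 1"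
    and "\<And>z. (\<forall>\<^sub>F y in F. y < z) \<or> (\<forall>\<^sub>F y in F. z \<le> y)"
  obtains L where "\<And>j. j \<in> {- int k..int n - 1} \<Longrightarrow> (basis j \<longlongrightarrow> L j) F"
    and "\<And>j. j \<in> {- int k..int n - 1} \<Longrightarrow> 0 \<le> L j"
    and "(\<Sum>j = - int k..int n - 1. L j) = 1"
    and "(\<Sum>j = - int k..int n - 1. greville x k j * L j) = c"
proof -
  have "\<exists>l. (basis j \<longlongrightarrow> l) F" if j: "j \<in> {- int k..int n - 1}" for j
  proof -
    obtain l where "(spline_dd x k j (j + int k + 1) \<longlongrightarrow> l) F"
      using spline_dd_tendsto[OF knot_mono _ _ assms(2,4), of j k] j by auto
    then have "(basis j \<longlongrightarrow> (x (j + int k + 1) - x j) * l) F"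
      unfolding basis_def[abs_def] by (intro tendsto_intros)
    then show ?thesis by blast
  qed
  then obtain L where L: "\<And>j. j \<in> {- int k..int n - 1} \<Longrightarrow> (basis j \<longlongrightarrow> L j) F"
    by metis
  have "0 \<le> L j" if "j \<in> {- int k..int n - 1}" for j
    using L[OF that] assms(1) basis_nonneg that by (intro tendsto_lowerbound[of "basis j"]) auto
  moreover have "(\<Sum>j = - int k..int n - 1. L j) = 1"
  proof (rule tendsto_unique[OF assms(1)])
    show "((\<lambda>y. \<Sum>j = - int k..int n - 1. basis j y) \<longlongrightarrow> (\<Sum>j = - int k..int n - 1. L j)) F"
      using L by (intro tendsto_sum)
    show "((\<lambda>y. \<Sum>j = - int k..int n - 1. basis j y) \<longlongrightarrow> 1) F"
      using assms(3) by (intro tendsto_eventually) (auto elim!: eventually_mono simp: sum_basis)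
  qed
  moreover have "(\<Sum>j = - int k..int n - 1. greville x k j * L j) = c"
  proof (rule tendsto_unique[OF assms(1)])
    show "((\<lambda>y. \<Sum>j = - int k..int n - 1. greville x k j * basis j y) \<longlongrightarrow> (\<Sum>j = - int k..int n - 1. greville x k j * L j)) F"
      using L by (intro tendsto_sum tendsto_intros)
    have "\<forall>\<^sub>F y in F. y = (\<Sum>j = - int k..int n - 1. greville x k j * basis j y)"
      using assms(3) by (auto elim!: eventually_mono simp: sum_greville_basis)
    from Lim_transform_eventually[OF assms(2) this]
    show "((\<lambda>y. \<Sum>j = - int k..int n - 1. greville x k j * basis j y) \<longlongrightarrow> c) F" .
  qed
  ultimately show ?thesis using that L by blast
qed

text \<open>The weights are chosen before \<open>f\<close>, which later makes the constant
  independent of \<open>f\<close>. Inside the interval they are the B-splines, at the endpoints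
  their one-sided limits.\<close>

lemma schoenberg_weights_exist:
  assumes "y \<in> {0..1}"
  obtains a where "\<And>j. j \<in> {- int k..int n - 1} \<Longrightarrow> 0 \<le> a j"
    and "(\<Sum>j = - int k..int n - 1. a j) = 1"
    and "(\<Sum>j = - int k..int n - 1. greville x k j * a j) = y"
    and "\<And>f. schoenberg n k x f y = (\<Sum>j = - int k..int n - 1. f (greville x k j) * a j)"
    and "0 < y \<Longrightarrow> y < 1 \<Longrightarrow> \<exists>j\<in>{- int k..int n - 1}. 0 < a j \<and> greville x k j \<noteq> y"
proof -
  consider "y = 0" | "y = 1" | "0 < y" "y < 1" using assms by force
  then show ?thesis
  proof cases
    case 1
    have 01: "\<forall>\<^sub>F u in at_right (0::real). 0 < u \<and> u < 1"
      using eventually_at_right_real[of 0 1] by (auto elim!: eventually_mono)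
    have z: "(\<forall>\<^sub>F u in at_right (0::real). u < z) \<or> (\<forall>\<^sub>F u in at_right 0. z \<le> u)" for z
    proof (cases "0 < z")
      case True
      then show ?thesis using eventually_at_right_real[of 0 z] by (auto elim!: eventually_mono)
    next
      case False
      then show ?thesis using 01 by (intro disjI2) (auto elim!: eventually_mono)
    qed
    obtain L where L: "\<And>j. j \<in> {- int k..int n - 1} \<Longrightarrow> (basis j \<longlongrightarrow> L j) (at_right 0)"
      "\<And>j. j \<in> {- int k..int n - 1} \<Longrightarrow> 0 \<le> L j" "(\<Sum>j = - int k..int n - 1. L j) = 1"
      "(\<Sum>j = - int k..int n - 1. greville x k j * L j) = 0"
      by (rule basis_limits[OF trivial_limit_at_right_real tendsto_ident_at 01 z]) blast
    have "bspline x k j 0 = L j" if j: "j \<in> {- int k..int n - 1}" for j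
    proof -
      have "\<forall>\<^sub>F u in at_right 0. basis j u = bspline_formula x k j u"
        using 01 j by (auto elim!: eventually_mono simp: bspline_formula_eq_basis)
      from Lim_transform_eventually[OF L(1)[OF j] this] show ?thesis
        by (auto simp: bspline_def intro!: tendsto_Lim)
    qed
    then have "schoenberg n k x f y = (\<Sum>j = - int k..int n - 1. f (greville x k j) * L j)" for f
      using 1 by (simp add: schoenberg_def schoenberg_sum_def)
    with 1 L(2-4) show ?thesis by (intro that[of L]) auto
  next
    case 2
    have 01: "\<forall>\<^sub>F u in at_left (1::real). 0 < u \<and> u < 1"
      using eventually_at_left_real[of 0 1] by (auto elim!: eventually_mono)
    have z: "(\<forall>\<^sub>F u in at_left (1::real). u < z) \<or> (\<forall>\<^sub>F u in at_left 1. z \<le> u)" for z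
    proof (cases "1 \<le> z")
      case True
      then show ?thesis using 01 by (intro disjI1) (auto elim!: eventually_mono)
    next
      case False
      then show ?thesis using eventually_at_left_real[of z 1] by (intro disjI2) (auto elim!: eventually_mono)
    qed
    obtain L where L: "\<And>j. j \<in> {- int k..int n - 1} \<Longrightarrow> (basis j \<longlongrightarrow> L j) (at_left 1)"
      "\<And>j. j \<in> {- int k..int n - 1} \<Longrightarrow> 0 \<le> L j" "(\<Sum>j = - int k..int n - 1. L j) = 1"
      "(\<Sum>j = - int k..int n - 1. greville x k j * L j) = 1"
      by (rule basis_limits[OF trivial_limit_at_left_real tendsto_ident_at 01 z]) blast
    \<comment> \<open>At 1 the operator is the limit of the whole sum, whereas at 0 the limit is
      taken in each B-spline.\<close>
    have "schoenberg n k x f y = (\<Sum>j = - int k..int n - 1. f (greville x k j) * L j)" for f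
    proof -
      have "((\<lambda>u. \<Sum>j = - int k..int n - 1. f (greville x k j) * basis j u) \<longlongrightarrow>
          (\<Sum>j = - int k..int n - 1. f (greville x k j) * L j)) (at_left 1)"
        using L(1) by (intro tendsto_sum tendsto_intros)
      moreover have "\<forall>\<^sub>F u in at_left 1. (\<Sum>j = - int k..int n - 1. f (greville x k j) * basis j u) = schoenberg_sum n k x f u"
        using 01 by (auto elim!: eventually_mono intro!: sum.cong
            simp: schoenberg_sum_def bspline_def bspline_formula_eq_basis)
      ultimately have "(schoenberg_sum n k x f \<longlongrightarrow> (\<Sum>j = - int k..int n - 1. f (greville x k j) * L j)) (at_left 1)"
        by (rule Lim_transform_eventually)
      then show ?thesis
        using 2 by (auto simp: schoenberg_def intro!: tendsto_Lim)
    qed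
    with 2 L(2-4) show ?thesis by (intro that[of L]) auto
  next
    case 3
    have "schoenberg n k x f y = (\<Sum>j = - int k..int n - 1. f (greville x k j) * basis j y)" for f
      using 3 by (auto simp: schoenberg_def schoenberg_sum_def bspline_def bspline_formula_eq_basis
          intro!: sum.cong)
    with 3 show ?thesis
      using basis_nonneg basis_pos_off_node sum_basis sum_greville_basis by (intro that[of "\<lambda>j. basis j y"]) auto
  qed
qed

end

subsection \<open>Maximum principle and moduli of smoothness\<close>

text \<open>If the maximum of \<open>F - C (1 - y\<^sup>2)\<close> over the nodes were attained at an interior node, averaging
  there would increase this function by at least \<open>C \<delta> - \<epsilon> > 0\<close>, the variance being the gain on
  \<open>y\<^sup>2\<close>; so it is attained at 0 or 1, where the function is at most 0.\<close>

lemma barrier_bound: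
  fixes \<xi> :: "'i \<Rightarrow> real" and a :: "real \<Rightarrow> 'i \<Rightarrow> real" and F :: "real \<Rightarrow> real"
  assumes I: "finite I" and \<xi>: "\<And>i. i \<in> I \<Longrightarrow> \<xi> i \<in> {0..1}"
    and a: "\<And>y i. y \<in> {0..1} \<Longrightarrow> i \<in> I \<Longrightarrow> 0 \<le> a y i"
      "\<And>y. y \<in> {0..1} \<Longrightarrow> (\<Sum>i\<in>I. a y i) = 1"
      "\<And>y. y \<in> {0..1} \<Longrightarrow> (\<Sum>i\<in>I. \<xi> i * a y i) = y"
    and \<delta>: "0 < \<delta>"
      "\<And>i. i \<in> I \<Longrightarrow> 0 < \<xi> i \<Longrightarrow> \<xi> i < 1 \<Longrightarrow> \<delta> \<le> (\<Sum>j\<in>I. (\<xi> j - \<xi> i)\<^sup>2 * a (\<xi> i) j)"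
    and F: "F 0 = 0" "F 1 = 0"
      "\<And>i. i \<in> I \<Longrightarrow> F (\<xi> i) - (\<Sum>j\<in>I. F (\<xi> j) * a (\<xi> i) j) \<le> \<epsilon>"
    and "0 \<le> \<epsilon>" and "i \<in> I"
  shows "F (\<xi> i) \<le> \<epsilon> / \<delta>"
proof (rule field_le_epsilon)
  fix \<eta> :: real assume "0 < \<eta>"
  \<comment> \<open>The slack \<open>\<eta>\<close> makes \<open>C\<close> positive and
    \<open>C * \<delta>\<close> strictly larger than \<open>\<epsilon>\<close>, even if
    \<open>\<epsilon> = 0\<close>.\<close>
  define C where "C = \<epsilon> / \<delta> + \<eta>"
  have C: "0 < C" "\<epsilon> < C * \<delta>"
    using \<open>0 < \<eta>\<close> \<open>0 < \<delta>\<close> \<open>0 \<le> \<epsilon>\<close> by (auto simp: C_def field_simps intro: add_nonneg_pos)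
  define u where "u y = F y - C * (1 - y\<^sup>2)" for y
  obtain m where m: "m \<in> I" "\<And>j. j \<in> I \<Longrightarrow> u (\<xi> j) \<le> u (\<xi> m)"
  proof -
    let ?U = "(\<lambda>j. u (\<xi> j)) ` I"
    have U: "finite ?U" "?U \<noteq> {}" using I \<open>i \<in> I\<close> by auto
    then obtain m where "m \<in> I" "u (\<xi> m) = Max ?U" using Max_in[of ?U] by (metis imageE)
    with Max_ge[OF U(1)] that show ?thesis by force
  qed
  have "u (\<xi> m) \<le> 0"
  proof (cases "0 < \<xi> m \<and> \<xi> m < 1")
    case False
    with \<xi>[OF m(1)] have "\<xi> m = 0 \<or> \<xi> m = 1" by auto
    then show ?thesis using F(1,2) C(1) by (auto simp: u_def)
  next
    case True
    let ?y = "\<xi> m"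
    note y = \<xi>[OF m(1)]
    have "(\<Sum>j\<in>I. (\<xi> j - ?y)\<^sup>2 * a ?y j) =
        (\<Sum>j\<in>I. (\<xi> j)\<^sup>2 * a ?y j) - 2 * ?y * (\<Sum>j\<in>I. \<xi> j * a ?y j) + ?y\<^sup>2 * (\<Sum>j\<in>I. a ?y j)"
      by (simp add: power2_diff algebra_simps sum.distrib sum_subtractf sum_distrib_left sum_distrib_right)
    then have var: "(\<Sum>j\<in>I. (\<xi> j)\<^sup>2 * a ?y j) \<ge> ?y\<^sup>2 + \<delta>"
      using \<delta>(2)[OF m(1)] True a(2,3)[OF y] by (simp add: power2_eq_square)
    have "(\<Sum>j\<in>I. u (\<xi> j) * a ?y j) =
        (\<Sum>j\<in>I. F (\<xi> j) * a ?y j) - C * (\<Sum>j\<in>I. a ?y j) + C * (\<Sum>j\<in>I. (\<xi> j)\<^sup>2 * a ?y j)"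
      by (simp add: u_def algebra_simps sum.distrib sum_subtractf sum_distrib_left)
    also have "\<dots> \<ge> (F ?y - \<epsilon>) - C + C * (?y\<^sup>2 + \<delta>)"
      using F(3)[OF m(1)] mult_left_mono[OF var, of C] C(1) unfolding a(2)[OF y] by linarith
    finally have "u ?y < (\<Sum>j\<in>I. u (\<xi> j) * a ?y j)"
      using C(2) by (simp add: u_def algebra_simps)
    also have "\<dots> \<le> (\<Sum>j\<in>I. u ?y * a ?y j)"
      using m(2) a(1)[OF y] by (intro sum_mono mult_right_mono) auto
    also have "\<dots> = u ?y"
      using a(2)[OF y] by (simp flip: sum_distrib_left)
    \<comment> \<open>The chain reads \<open>u ?y < u ?y\<close>, so an interior maximum is
      impossible.\<close>
    finally show ?thesis by simp
  qed
  then have "F (\<xi> i) \<le> C * (1 - (\<xi> i)\<^sup>2)"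
    using m(2)[OF \<open>i \<in> I\<close>] by (simp add: u_def)
  also have "\<dots> \<le> C * 1"
    using C(1) by (intro mult_left_mono) auto
  finally show "F (\<xi> i) \<le> \<epsilon> / \<delta> + \<eta>" by (simp add: C_def)
qed

section \<open>Forward differences and the modulus of smoothness\<close>

lemma forward_difference_Suc:
  "forward_difference (Suc r) h f x = forward_difference r h f (x + h) - forward_difference r h f x"
proof -
  let ?g = "\<lambda>l. f (x + real l * h)"
  have "forward_difference (Suc r) h f x =
      (-1) ^ Suc r * ?g 0 + (\<Sum>l = 0..r. (-1) ^ (r - l) * real (Suc r choose Suc l) * ?g (Suc l))"
    unfolding forward_difference_def by (subst sum.atLeast0_atMost_Suc_shift) simp
  \<comment> \<open>Pascal's rule separates the difference at \<open>x + h\<close> from the terms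
    belonging to the one at \<open>x\<close>.\<close>
  also have "(\<Sum>l = 0..r. (-1) ^ (r - l) * real (Suc r choose Suc l) * ?g (Suc l)) =
     (\<Sum>l = 0..r. (-1) ^ (r - l) * real (r choose l) * ?g (Suc l)) +
     (\<Sum>l = 0..r. (-1) ^ (r - l) * real (r choose Suc l) * ?g (Suc l))"
    by (simp add: algebra_simps sum.distrib)
  also have "(\<Sum>l = 0..r. (-1) ^ (r - l) * real (r choose l) * ?g (Suc l)) = forward_difference r h f (x + h)"
    by (simp add: forward_difference_def algebra_simps)
  also have "(-1) ^ Suc r * ?g 0 + (forward_difference r h f (x + h) +
      (\<Sum>l = 0..r. (-1) ^ (r - l) * real (r choose Suc l) * ?g (Suc l))) =
      forward_difference r h f (x + h) - forward_difference r h f x"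
  proof (cases r)
    case (Suc r')
    \<comment> \<open>The term \<open>l = r\<close> has binomial coefficient 0. Without it
      \<open>r - l = Suc (r - Suc l)\<close> holds throughout, which yields the change of
      sign.\<close>
    have "(\<Sum>l = 0..r. (-1) ^ (r - l) * real (r choose Suc l) * ?g (Suc l)) =
        (\<Sum>l = 0..r'. (-1) ^ (r - l) * real (r choose Suc l) * ?g (Suc l))"
      unfolding Suc by (simp add: binomial_eq_0)
    also have "\<dots> = - (\<Sum>l = 0..r'. (-1) ^ (r - Suc l) * real (r choose Suc l) * ?g (Suc l))"
      unfolding sum_negf[symmetric] by (intro sum.cong refl) (simp add: Suc Suc_diff_le)
    finally have "(\<Sum>l = 0..r. (-1) ^ (r - l) * real (r choose Suc l) * ?g (Suc l)) = \<dots>" .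
    moreover have "forward_difference r h f x =
        (-1) ^ r * ?g 0 + (\<Sum>l = 0..r'. (-1) ^ (r - Suc l) * real (r choose Suc l) * ?g (Suc l))"
      unfolding forward_difference_def Suc by (subst sum.atLeast0_atMost_Suc_shift) simp
    ultimately show ?thesis by simp
  qed (simp add: forward_difference_def)
  finally show ?thesis .
qed

lemma forward_difference_affine_eq_0:
  assumes "r \<ge> 2"
  shows "forward_difference r h (\<lambda>y. a + b * y) x = 0"
  using assms
proof (induction r arbitrary: x rule: nat_induct_at_least)
  case base
  show ?case by (simp add: forward_difference_def numeral_2_eq_2 algebra_simps)
next
  case (Suc r)
  then show ?case by (simp add: forward_difference_Suc)
qed

lemma forward_difference_add:
  "forward_difference r h (\<lambda>y. f y + g y) x = forward_difference r h f x + forward_difference r h g x"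
  by (simp add: forward_difference_def algebra_simps sum.distrib)

text \<open>All sample points stay in the unit interval, and the binomial coefficients of row
  \<open>r\<close> add up to \<open>2 ^ r\<close>.\<close>

lemma abs_forward_difference_le:
  assumes "\<And>y. y \<in> {0..1} \<Longrightarrow> \<bar>f y\<bar> \<le> B" "0 \<le> h" "x \<in> {0..1 - real r * h}"
  shows "\<bar>forward_difference r h f x\<bar> \<le> 2 ^ r * B"
proof -
  have "\<bar>forward_difference r h f x\<bar> \<le> (\<Sum>l = 0..r. real (r choose l) * B)"
    unfolding forward_difference_def
  proof (rule order.trans[OF sum_abs sum_mono])
    fix l assume l: "l \<in> {0..r}"
    have "real l * h \<le> real r * h" using l assms(2) by (intro mult_right_mono) auto
    then have "x + real l * h \<in> {0..1}" using assms(2,3) by auto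
    then show "\<bar>(-1) ^ (r - l) * real (r choose l) * f (x + real l * h)\<bar> \<le> real (r choose l) * B"
      using assms(1) by (auto simp: abs_mult intro!: mult_left_mono)
  qed
  also have "\<dots> = 2 ^ r * B"
    using choose_row_sum[of r] by (simp flip: sum_distrib_right of_nat_sum add: atMost_atLeast0)
  finally show ?thesis .
qed

text \<open>The first two assumptions keep both index sets nonempty, as a bound on real suprema
  requires.\<close>

lemma modulus_of_smoothness_le:
  assumes "0 < t" "real r * t \<le> 1"
    and "\<And>h x. 0 < h \<Longrightarrow> h < t \<Longrightarrow> x \<in> {0..1 - real r * h} \<Longrightarrow> \<bar>forward_difference r h f x\<bar> \<le> B"
  shows "modulus_of_smoothness r f t \<le> B"
  unfolding modulus_of_smoothness_def
proof (intro cSUP_least)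
  fix h assume h: "h \<in> {0<..<t}"
  then have "real r * h \<le> real r * t" by (intro mult_left_mono) auto
  then show "{0..1 - real r * h} \<noteq> {}" using assms(2) by auto
qed (use assms in auto)

theorem theorem5:
  fixes n k r :: nat and t :: real and x :: "int \<Rightarrow> real"
  assumes "n > 0" and "r \<ge> 2" and "k > r"
    and "0 < t" and "t \<le> 1 / real r"
    and "knot_sequence n k x"
  shows "\<exists>M>0. \<forall>f::real \<Rightarrow> real. continuous_on {0..1} f \<longrightarrow>
           M * modulus_of_smoothness r f t \<le> uniform_norm (\<lambda>y. f y - schoenberg n k x f y)"
proof -
  interpret schoenberg_knots n k x
    using assms by unfold_locales auto
  define I where "I = {- int k..int n - 1}"
  let ?\<xi> = "greville x k" and ?S = "schoenberg n k x"
  have fin: "finite I" by (simp add: I_def)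
  have \<xi>: "?\<xi> i \<in> {0..1}" if "i \<in> I" for i
    using greville_bounds that by (auto simp: I_def)
  \<comment> \<open>The quantifier over \<open>f\<close> stands inside the choice of
    \<open>a\<close>, so one family of weights serves all functions.\<close>
  have "\<forall>y\<in>{0..1}. \<exists>a. (\<forall>j\<in>I. 0 \<le> a j) \<and> (\<Sum>j\<in>I. a j) = 1 \<and> (\<Sum>j\<in>I. ?\<xi> j * a j) = y \<and>
      (\<forall>f. ?S f y = (\<Sum>j\<in>I. f (?\<xi> j) * a j)) \<and>
      (0 < y \<longrightarrow> y < 1 \<longrightarrow> (\<exists>j\<in>I. 0 < a j \<and> ?\<xi> j \<noteq> y))"
    unfolding I_def by (rule ballI, erule schoenberg_weights_exist) blast
  then obtain a where a: "\<And>y j. y \<in> {0..1} \<Longrightarrow> j \<in> I \<Longrightarrow> 0 \<le> a y j"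
    "\<And>y. y \<in> {0..1} \<Longrightarrow> (\<Sum>j\<in>I. a y j) = 1"
    "\<And>y. y \<in> {0..1} \<Longrightarrow> (\<Sum>j\<in>I. ?\<xi> j * a y j) = y"
    and S: "\<And>y f. y \<in> {0..1} \<Longrightarrow> ?S f y = (\<Sum>j\<in>I. f (?\<xi> j) * a y j)"
    and off: "\<And>y. y \<in> {0..1} \<Longrightarrow> 0 < y \<Longrightarrow> y < 1 \<Longrightarrow> \<exists>j\<in>I. 0 < a y j \<and> ?\<xi> j \<noteq> y"
    unfolding bchoice_iff by blast

  let ?var = "\<lambda>i. \<Sum>j\<in>I. (?\<xi> j - ?\<xi> i)\<^sup>2 * a (?\<xi> i) j"
  have var_pos: "0 < ?var i" if i: "i \<in> I" "0 < ?\<xi> i" "?\<xi> i < 1" for i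
  proof -
    obtain j where "j \<in> I" "0 < a (?\<xi> i) j" "?\<xi> j \<noteq> ?\<xi> i"
      using off[OF \<xi>[OF i(1)] i(2,3)] by blast
    then show ?thesis
      using fin a(1)[OF \<xi>[OF i(1)]] by (intro sum_pos2[of _ j]) auto
  qed
  \<comment> \<open>The inserted 1 guarantees that the minimum is over a nonempty set.\<close>
  define \<delta> where "\<delta> = Min (insert 1 (?var ` {i \<in> I. 0 < ?\<xi> i \<and> ?\<xi> i < 1}))"
  have \<delta>: "0 < \<delta>" "\<And>i. i \<in> I \<Longrightarrow> 0 < ?\<xi> i \<Longrightarrow> ?\<xi> i < 1 \<Longrightarrow> \<delta> \<le> ?var i"
    unfolding \<delta>_def using fin var_pos by (auto intro!: Min_le)

  \<comment> \<open>The factor \<open>2 ^ r\<close> comes from the \<open>r\<close>-th difference,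
    the factor \<open>1 + 1 / \<delta>\<close> from bounding \<open>F\<close> by the
    residual.\<close>
  define M where "M = 1 / (2 ^ r * (1 + 1 / \<delta>))"
  have "M > 0" unfolding M_def using \<delta>(1) by (intro divide_pos_pos mult_pos_pos add_pos_pos) auto
  moreover have "M * modulus_of_smoothness r f t \<le> uniform_norm (\<lambda>y. f y - ?S f y)"
    if cont: "continuous_on {0..1} f" for f :: "real \<Rightarrow> real"
  proof -
    define \<epsilon> where "\<epsilon> = uniform_norm (\<lambda>y. f y - ?S f y)"
    \<comment> \<open>Boundedness of \<open>f\<close> makes the residual bounded, so that the
      supremum in \<open>uniform_norm\<close> really dominates it.\<close>
    obtain B where B: "\<And>y. y \<in> {0..1} \<Longrightarrow> \<bar>f y\<bar> \<le> B"
      using compact_imp_bounded[OF compact_continuous_image[OF cont compact_Icc]]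
      by (force simp: bounded_iff)
    have S_bound: "\<bar>?S g y\<bar> \<le> K" if "y \<in> {0..1}" "\<And>j. j \<in> I \<Longrightarrow> \<bar>g (?\<xi> j)\<bar> \<le> K" for g y K
    proof -
      have "\<bar>?S g y\<bar> \<le> (\<Sum>j\<in>I. K * a y j)"
        unfolding S[OF that(1)] using a(1)[OF that(1)] that(2)
        by (intro order.trans[OF sum_abs sum_mono]) (auto simp: abs_mult intro!: mult_right_mono)
      then show ?thesis using a(2)[OF that(1)] by (simp flip: sum_distrib_left)
    qed
    have \<epsilon>: "\<bar>f y - ?S f y\<bar> \<le> \<epsilon>" if "y \<in> {0..1}" for y
      unfolding \<epsilon>_def uniform_norm_def
    proof (rule cSUP_upper[OF that])
      have "\<bar>f y - ?S f y\<bar> \<le> B + B" if "y \<in> {0..1}" for y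
        using B[OF that] S_bound[OF that, of f B] B \<xi> by fastforce
      then show "bdd_above ((\<lambda>y. \<bar>f y - ?S f y\<bar>) ` {0..1})" by (rule bdd_aboveI2)
    qed
    have "0 \<le> \<epsilon>" using \<epsilon>[of 0] by simp

    define l where "l y = f 0 + (f 1 - f 0) * y" for y
    define F where "F y = f y - l y" for y
    have F01: "F 0 = 0" "F 1 = 0" by (simp_all add: F_def l_def)
    have SF: "?S F y = ?S f y - l y" if "y \<in> {0..1}" for y
    proof -
      \<comment> \<open>Mass 1 and mean \<open>y\<close> of the weights mean that affine functions
        are reproduced.\<close>
      have "?S F y = ?S f y - f 0 * (\<Sum>j\<in>I. a y j) - (f 1 - f 0) * (\<Sum>j\<in>I. ?\<xi> j * a y j)"
        unfolding S[OF that] F_def l_def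
        by (simp add: algebra_simps sum.distrib sum_subtractf sum_distrib_left)
      then show ?thesis using a(2,3)[OF that] by (simp add: l_def)
    qed
    have res: "\<bar>F y - ?S F y\<bar> \<le> \<epsilon>" if "y \<in> {0..1}" for y
      using \<epsilon>[OF that] SF[OF that] by (simp add: F_def)
    have F_node: "\<bar>F (?\<xi> i)\<bar> \<le> \<epsilon> / \<delta>" if i: "i \<in> I" for i
    proof -
      have "F (?\<xi> i) \<le> \<epsilon> / \<delta>"
        using res[OF \<xi>] S[OF \<xi>, of _ F] \<open>0 \<le> \<epsilon>\<close>
        by (intro barrier_bound[OF fin \<xi> a \<delta> _ _ _ _ i]) (auto simp: F01 abs_le_iff)
      \<comment> \<open>The two-sided residual bound and the zero boundary values are invariant
        under a change of sign, so the barrier also bounds \<open>F\<close> from below.\<close>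
      moreover have "- F (?\<xi> i) \<le> \<epsilon> / \<delta>"
        using res[OF \<xi>] S[OF \<xi>, of _ F] \<open>0 \<le> \<epsilon>\<close>
        by (intro barrier_bound[OF fin \<xi> a \<delta> _ _ _ _ i, where F = "\<lambda>y. - F y"])
          (auto simp: F01 abs_le_iff sum_negf)
      ultimately show ?thesis by simp
    qed

    have "modulus_of_smoothness r f t \<le> 2 ^ r * (1 + 1 / \<delta>) * \<epsilon>"
    proof (rule modulus_of_smoothness_le[OF \<open>0 < t\<close>])
      show "real r * t \<le> 1" using assms(2,5) by (simp add: field_simps)
      fix h y assume h: "0 < h" "h < t" "y \<in> {0..1 - real r * h}"
      have "forward_difference r h f y =
          forward_difference r h (\<lambda>y. (f 0 + (f 1 - f 0) * y) + F y) y"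
        by (simp add: F_def l_def)
      also have "\<dots> = forward_difference r h F y"
        by (subst forward_difference_add) (simp add: forward_difference_affine_eq_0[OF assms(2)])
      finally have "forward_difference r h f y = forward_difference r h F y" .
      moreover have "\<bar>F z\<bar> \<le> \<epsilon> + \<epsilon> / \<delta>" if "z \<in> {0..1}" for z
        using res[OF that] S_bound[OF that, of F "\<epsilon> / \<delta>"] F_node by fastforce
      then have "\<bar>forward_difference r h F y\<bar> \<le> 2 ^ r * (\<epsilon> + \<epsilon> / \<delta>)"
        using h by (intro abs_forward_difference_le) auto
      ultimately show "\<bar>forward_difference r h f y\<bar> \<le> 2 ^ r * (1 + 1 / \<delta>) * \<epsilon>"
        by (simp add: algebra_simps)
    qed
    moreover have "2 ^ r * (1 + 1 / \<delta>) > 0"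
      using \<delta>(1) by (intro mult_pos_pos add_pos_pos) auto
    ultimately show ?thesis
      unfolding M_def \<epsilon>_def[symmetric] by (simp add: divide_le_eq mult.commute)
  qed
  ultimately show ?thesis by blast
qed

end
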